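(* Let $\langle X,\tau\rangle$ be a Hausdorff topological space and $S\subseteq X$ a subset such that both $S$ and $X\setminus S$ are dense in $X$. If the subspace $\langle S,\tau\upharpoonright S\rangle$ is homeomorphic to the Sorgenfrey line, then $\langle X,\tau\rangle$ is not a continuous open image of the Sorgenfrey line.
   Context: The Sorgenfrey line is $\mathbb R$ with topology generated by $\{[a,b):a,b\in\mathbb R\}$; "continuous open image" means image under a continuous open surjection. *)

theory Defs
  imports "HOL-Analysis.Analysis"
begin

definition sorgenfrey_line :: "real topology" where
  "sorgenfrey_line = topology_generated_by {{a..<b} | a b. True}"

end

theory Submission
  imports Defs
begin

text \<open>
  Let \<open>f\<close> be a continuous open map from the Sorgenfrey line to \<open>X\<close> and let \<open>e\<close> be a
  homeomorphism of the Sorgenfrey line onto \<open>S\<close>.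

  If \<open>f\<close> is injective on no interval \<open>{p..<q}\<close>, then, since \<open>f\<close> is open and \<open>S\<close> is dense, one
  finds intervals \<open>{p n..<q n}\<close> shrinking to a point \<open>y\<close> and a point \<open>z\<close>, approached from below
  by \<open>t n < z\<close>, such that \<open>f ` {y..<q n}\<close> contains both \<open>e z\<close> and \<open>e (t n)\<close> for all \<open>n\<close>.
  The first forces \<open>f y = e z\<close>; then \<open>f\<close> must map some \<open>{y..<q n}\<close> off \<open>e ` {..<z}\<close>,
  contradicting the second.

  If \<open>f\<close> is injective on \<open>{p..<q}\<close>, then \<open>e\<close> lifts through \<open>f\<close> to a map \<open>g\<close> on some interval, and
  by the Baire category theorem \<open>g\<close> is strictly increasing on a subinterval. A point of
  \<open>X - S\<close> near that part of \<open>S\<close> lifts to a point \<open>y\<close> lying in a gap of the range of \<open>g\<close>, so an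
  open set around it misses \<open>S\<close>, contradicting density.
\<close>

section \<open>Neighbourhoods in the Sorgenfrey line\<close>

lemma openin_sorgenfrey_line_atLeastLessThan: "openin sorgenfrey_line {a..<b}"
  unfolding sorgenfrey_line_def by (rule topology_generated_by_Basis) blast

text \<open>A basic interval containing \<open>x\<close> also contains one with left endpoint
  \<open>x\<close>, so right-hand neighbourhoods suffice.\<close>

lemma openin_sorgenfrey_line:
  "openin sorgenfrey_line U \<longleftrightarrow> (\<forall>x\<in>U. \<exists>\<epsilon>>0. {x..<x+\<epsilon>} \<subseteq> U)"
proof
  assume "openin sorgenfrey_line U"
  then have "generate_topology_on {{a..<b} | a b. True} U"
    by (simp add: sorgenfrey_line_def openin_topology_generated_by_iff)
  then show "\<forall>x\<in>U. \<exists>\<epsilon>>0. {x..<x+\<epsilon>} \<subseteq> U"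
  proof induction
    case Empty
    show ?case by simp
  next
    case (Int A B)
    show ?case
    proof
      fix x assume "x \<in> A \<inter> B"
      then obtain c d where "c > 0" "{x..<x+c} \<subseteq> A" "d > 0" "{x..<x+d} \<subseteq> B"
        using Int.IH by blast
      then have "min c d > 0" "{x..<x + min c d} \<subseteq> A \<inter> B" by (auto simp: subset_iff)
      then show "\<exists>\<epsilon>>0. {x..<x+\<epsilon>} \<subseteq> A \<inter> B" by blast
    qed
  next
    case (UN K)
    then show ?case by (meson Union_iff Union_upper order_trans)
  next
    case (Basis A)
    then obtain a b where A: "A = {a..<b}" by blast
    show ?case
    proof
      fix x assume "x \<in> A"
      then have "b - x > 0" "{x..<x+(b-x)} \<subseteq> A" using A by auto
      then show "\<exists>\<epsilon>>0. {x..<x+\<epsilon>} \<subseteq> A" by blast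
    qed
  qed
next
  assume *: "\<forall>x\<in>U. \<exists>\<epsilon>>0. {x..<x+\<epsilon>} \<subseteq> U"
  have "\<exists>T. openin sorgenfrey_line T \<and> x \<in> T \<and> T \<subseteq> U" if x: "x \<in> U" for x
  proof -
    obtain d where "d > 0" "{x..<x+d} \<subseteq> U" using * x by blast
    then show ?thesis using openin_sorgenfrey_line_atLeastLessThan[of x "x+d"]
      by (intro exI[of _ "{x..<x+d}"]) simp
  qed
  then show "openin sorgenfrey_line U"
    by (subst openin_subopen) blast
qed

lemma topspace_sorgenfrey_line [simp]: "topspace sorgenfrey_line = UNIV"
proof -
  have "openin sorgenfrey_line UNIV"
    unfolding openin_sorgenfrey_line using zero_less_one by blast
  then show ?thesis using openin_subset by blast
qed

lemma continuous_map_sorgenfrey_lineD: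
  assumes "continuous_map sorgenfrey_line X f" "openin X U" "f r \<in> U"
  obtains \<epsilon> where "\<epsilon> > 0" "f ` {r..<r+\<epsilon>} \<subseteq> U"
proof -
  have "openin sorgenfrey_line {x. f x \<in> U}"
    using openin_continuous_map_preimage[OF assms(1,2)] by simp
  then obtain \<epsilon> where "\<epsilon> > 0" "{r..<r+\<epsilon>} \<subseteq> {x. f x \<in> U}"
    using assms(3) unfolding openin_sorgenfrey_line by blast
  then show ?thesis by (intro that) auto
qed

text \<open>Baire category: if every \<open>E n\<close> were nowhere dense in the interval, some
  point of it would avoid all of them.\<close>

lemma countable_cover_dense_in_interval:
  fixes E :: "nat \<Rightarrow> real set"
  assumes "s < s'" and cover: "{s<..<s'} \<subseteq> (\<Union>n. E n)"
  obtains n a b where "s < a" "a < b" "b < s'" "{a<..<b} \<subseteq> closure (E n)"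
proof -
  have "\<exists>n. interior (closure (E n)) \<inter> {s<..<s'} \<noteq> {}"
  proof (rule ccontr)
    assume none: "\<nexists>n. interior (closure (E n)) \<inter> {s<..<s'} \<noteq> {}"
    \<comment> \<open>Cutting down to \<open>{s..s'}\<close> before complementing makes
      \<open>G n\<close> dense on the whole line, although \<open>E n\<close> is arbitrary outside
      the interval.\<close>
    define G where "G n = - ({s..s'} \<inter> closure (E n))" for n
    have "interior ({s..s'} \<inter> closure (E n)) = {}" for n
      using none by (auto simp: interior_Int)
    then have "closure (G n) = UNIV" for n
      by (simp only: G_def closure_complement Compl_empty_eq)
    moreover have "open (G n)" for n
      unfolding G_def by (intro open_Compl closed_Int) auto
    ultimately have "UNIV \<subseteq> closure (\<Inter>(range G))"
      by (intro Baire) auto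
    then obtain x where "x \<in> \<Inter>(range G)" "x \<in> {s<..<s'}"
      using open_Int_closure_eq_empty[of "{s<..<s'}" "\<Inter>(range G)"] \<open>s < s'\<close>
      by (metis disjoint_iff greaterThanLessThan_empty_iff inf_top.right_neutral
          linorder_not_le open_greaterThanLessThan top.extremum_unique)
    moreover obtain n where "x \<in> E n" using cover calculation(2) by blast
    ultimately show False
      using closure_subset[of "E n"] by (auto simp: G_def)
  qed
  then obtain n x where x: "x \<in> interior (closure (E n)) \<inter> {s<..<s'}" by blast
  have "open (interior (closure (E n)) \<inter> {s<..<s'})" by (intro open_Int) auto
  then obtain d where "d > 0" and d: "cball x d \<subseteq> interior (closure (E n)) \<inter> {s<..<s'}"
    using x open_contains_cball by metis
  have "{x-d..x+d} \<subseteq> closure (E n) \<inter> {s<..<s'}"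
    using d interior_subset[of "closure (E n)"] by (auto simp: cball_eq_atLeastAtMost)
  moreover have "x - d \<in> {x-d..x+d}" "x + d \<in> {x-d..x+d}" using \<open>d > 0\<close> by auto
  ultimately show ?thesis
    using \<open>d > 0\<close> by (intro that[of "x-d" "x+d" n]) (auto simp: subset_iff)
qed

text \<open>\<open>range e\<close> plays the role of \<open>S\<close>. Openness of \<open>e\<close>
  onto its image is encoded by open sets of \<open>X\<close> whose traces are the basic intervals,
  which avoids the subspace topology.\<close>

locale dense_codense_sorgenfrey_copy =
  fixes X :: "'a topology" and f e :: "real \<Rightarrow> 'a"
  assumes t1: "t1_space X"
    and continuous_f: "continuous_map sorgenfrey_line X f"
    and open_f: "open_map sorgenfrey_line X f"
    and continuous_e: "continuous_map sorgenfrey_line X e"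
    and embedding_e: "\<exists>U. openin X U \<and> (\<forall>v. e v \<in> U \<longleftrightarrow> v \<in> {s..<s'})"
    and dense: "\<lbrakk>openin X U; U \<noteq> {}\<rbrakk> \<Longrightarrow> \<exists>s. e s \<in> U"
    and codense: "\<lbrakk>openin X U; U \<noteq> {}\<rbrakk> \<Longrightarrow> U - range e \<noteq> {}"
begin

lemmas f_contD = continuous_map_sorgenfrey_lineD[OF continuous_f]
lemmas e_contD = continuous_map_sorgenfrey_lineD[OF continuous_e]

lemma openin_image: "openin X (f ` {r..<r'})"
  using open_f openin_sorgenfrey_line_atLeastLessThan by (simp add: open_map_def)

lemma inj_e: "inj e"
proof (rule linorder_injI)
  fix s s' :: real assume "s < s'"
  then show "e s \<noteq> e s'" using embedding_e[of s' "s'+1"]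
    by (metis atLeastLessThan_iff less_add_one linorder_not_le order_refl)
qed

section \<open>Maps injective on no interval\<close>

lemma inj_on_some_interval: "\<exists>p q. p < q \<and> inj_on f {p..<q}"
proof (rule ccontr)
  assume "\<nexists>p q. p < q \<and> inj_on f {p..<q}"
  then have not_inj: "\<not> inj_on f {p..<q}" if "p < q" for p q using that by blast
  have step: "\<exists>p' q' t u b' b. p \<le> p' \<and> p' < q' \<and> q' < q \<and> q' - p' \<le> (q - p) / 2
      \<and> t < u \<and> u \<le> b' \<and> b' < b \<and> e ` {t..<b} \<subseteq> f ` {q'..<q} \<and> (\<forall>v. e v \<in> f ` {p'..<q'} \<longrightarrow> u \<le> v \<and> v \<le> b')"
    if "p < q" for p q
  proof -
    have "\<exists>y y'. p \<le> y \<and> y < y' \<and> y' < q \<and> f y = f y'"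
      using not_inj[OF that] linorder_inj_onI'[of "{p..<q}" f] by fastforce
    then obtain y y' where y: "p \<le> y" "y < y'" "y' < q" "f y = f y'" by blast
    \<comment> \<open>\<open>N\<close> consists of values taken on both sides of \<open>y'\<close>:
      the left preimages are kept, the right ones discarded.\<close>
    define N where "N = f ` {y..<y'} \<inter> f ` {y'..<q}"
    have "openin X N" unfolding N_def by (intro openin_Int openin_image)
    moreover have "f y \<in> N"
      using y imageI[of y "{y..<y'}" f] imageI[of y' "{y'..<q}" f] by (simp add: N_def)
    ultimately obtain t where t: "e t \<in> N" using dense by blast
    obtain \<delta> where \<delta>: "\<delta> > 0" "e ` {t..<t+\<delta>} \<subseteq> N" using e_contD[OF \<open>openin X N\<close> t] .
    \<comment> \<open>The middle third leaves a margin on both sides, giving the strict inequalities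
      \<open>t < u\<close> and \<open>b' < b\<close>.\<close>
    define u b' where "u = t + \<delta>/3" and "b' = t + 2*\<delta>/3"
    have "e u \<in> N" using \<delta> by (auto simp: u_def)
    then obtain w where w: "y \<le> w" "w < y'" "f w = e u" by (auto simp: N_def)
    obtain U where U: "openin X U" "\<And>v. e v \<in> U \<longleftrightarrow> v \<in> {u..<b'}"
      using embedding_e[of u b'] by blast
    have "f w \<in> U" using U(2)[of u] \<delta> by (simp add: w u_def b'_def)
    then obtain \<eta> where \<eta>: "\<eta> > 0" "f ` {w..<w+\<eta>} \<subseteq> U" using f_contD[OF U(1)] by blast
    \<comment> \<open>The three bounds keep the image inside \<open>U\<close>, leave
      \<open>{y'..<q}\<close> in the discarded part, and halve the length.\<close>
    define q' where "q' = min (w + \<eta>) (min y' (w + (q - p)/2))"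
    have q': "w < q'" "q' \<le> y'" "q' \<le> w + \<eta>" "q' - w \<le> (q - p)/2"
      using w(2) \<eta>(1) that unfolding q'_def by (simp, linarith+)
    have "e ` {t..<t+\<delta>} \<subseteq> f ` {q'..<q}"
      using \<delta>(2) q'(2) image_mono[of "{y'..<q}" "{q'..<q}" f] by (auto simp: N_def)
    moreover have "\<forall>v. e v \<in> f ` {w..<q'} \<longrightarrow> u \<le> v \<and> v \<le> b'"
    proof -
      have "{w..<q'} \<subseteq> {w..<w+\<eta>}" using q'(3) by auto
      then have "f ` {w..<q'} \<subseteq> U" using \<eta>(2) by (meson image_mono order_trans)
      then have "v \<in> {u..<b'}" if "e v \<in> f ` {w..<q'}" for v using U(2) that by blast
      then show ?thesis by (meson atLeastLessThan_iff less_imp_le)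
    qed
    moreover have "p \<le> w" "q' < q" using w y q' by linarith+
    moreover have "t < u" "u \<le> b'" "b' < t + \<delta>" using \<delta>(1) by (simp_all add: u_def b'_def)
    ultimately show ?thesis using q'(1,4) by meson
  qed
  define R where "R P Q \<longleftrightarrow> (\<exists>t u b' b. fst P \<le> fst Q \<and> fst Q < snd Q \<and> snd Q < snd P
      \<and> snd Q - fst Q \<le> (snd P - fst P) / 2
      \<and> t < u \<and> u \<le> b' \<and> b' < b \<and> e ` {t..<b} \<subseteq> f ` {snd Q..<snd P}
      \<and> (\<forall>v. e v \<in> f ` {fst Q..<snd Q} \<longrightarrow> u \<le> v \<and> v \<le> b'))" for P Q :: "real \<times> real"
  obtain P where P: "\<And>n. fst (P n) < snd (P n)" "\<And>n. R (P n) (P (Suc n))"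
  proof -
    have "\<exists>P. \<forall>n. fst (P n) < snd (P n) \<and> R (P n) (P (Suc n))"
    proof (rule dependent_nat_choice)
      show "\<exists>x::real\<times>real. fst x < snd x" by (rule exI[of _ "(0,1)"]) simp
      fix x :: "real \<times> real" and n :: nat assume "fst x < snd x"
      from step[OF this] obtain p' q' where "R x (p', q')" "p' < q'"
        unfolding R_def by (metis fst_conv snd_conv)
      then show "\<exists>y. fst y < snd y \<and> R x y" by (metis fst_conv snd_conv)
    qed
    then show ?thesis using that by blast
  qed
  define p q where "p n = fst (P n)" and "q n = snd (P n)" for n
  have "\<forall>n. \<exists>t u b' b. t < u \<and> u \<le> b' \<and> b' < b \<and> e ` {t..<b} \<subseteq> f ` {q (Suc n)..<q n}
      \<and> (\<forall>v. e v \<in> f ` {p (Suc n)..<q (Suc n)} \<longrightarrow> u \<le> v \<and> v \<le> b')"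
    using P(2) unfolding R_def p_def q_def by meson
  then obtain t u b' b where tu: "\<And>n. t n < u n" and "\<And>n. u n \<le> b' n" and b: "\<And>n. b' n < b n"
    and cover: "\<And>n. e ` {t n..<b n} \<subseteq> f ` {q (Suc n)..<q n}"
    and confine: "\<And>n v. e v \<in> f ` {p (Suc n)..<q (Suc n)} \<Longrightarrow> u n \<le> v \<and> v \<le> b' n"
    by metis
  then have tb: "t n < b n" for n by (meson less_le_trans less_trans)
  have pq: "p n < q n" "p n \<le> p (Suc n)" "q (Suc n) < q n"
      "q (Suc n) - p (Suc n) \<le> (q n - p n)/2" for n
    using P unfolding R_def p_def q_def by blast+
  have "incseq p" "decseq q"
    using pq(2) less_imp_le[OF pq(3)] by (blast intro: incseq_SucI decseq_SucI)+
  have len: "q n - p n \<le> (q 0 - p 0) / 2^n" for n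
  proof (induction n)
    case (Suc n)
    have "q (Suc n) - p (Suc n) \<le> (q n - p n)/2" by (rule pq(4))
    also have "\<dots> \<le> ((q 0 - p 0) / 2^n)/2" using Suc by (intro divide_right_mono) auto
    finally show ?case by simp
  qed simp
  have p_le_q: "p m \<le> q n" for m n
    using \<open>incseq p\<close> \<open>decseq q\<close> pq(1)[of "max m n"]
    by (smt (verit) incseq_def decseq_def max.cobounded1 max.cobounded2)
  define y where "y = (SUP n. p n)"
  have bdd: "bdd_above (range p)" using p_le_q[of _ 0] by (auto intro!: bdd_aboveI)
  have y_ge: "p n \<le> y" for n unfolding y_def using bdd by (intro cSUP_upper) auto
  have y_le: "y \<le> q n" for n unfolding y_def using p_le_q by (intro cSUP_least) auto
  have near: "\<exists>n. {y..<q n} \<subseteq> {y..<y+\<epsilon>}" if "\<epsilon> > 0" for \<epsilon>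
  proof -
    obtain n where "(q 0 - p 0) / \<epsilon> < 2^n" using real_arch_pow[of 2] by auto
    then have "(q 0 - p 0) / 2^n < \<epsilon>" using that by (simp add: field_simps)
    then have "q n < y + \<epsilon>" using len[of n] y_ge[of n] by linarith
    then show ?thesis by (intro exI[of _ n]) auto
  qed
  \<comment> \<open>The part discarded at stage \<open>Suc n\<close> lies in the part kept at stage
    \<open>n\<close>, so \<open>confine\<close> applies to what it covers.\<close>
  have nested: "u n \<le> t (Suc n)" "b (Suc n) \<le> b' n" for n
  proof -
    have sub: "f ` {q (Suc (Suc n))..<q (Suc n)} \<subseteq> f ` {p (Suc n)..<q (Suc n)}"
      using p_le_q by (intro image_mono) auto
    have *: "u n \<le> v \<and> v \<le> b' n" if "t (Suc n) \<le> v" "v < b (Suc n)" for v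
    proof -
      have "e v \<in> e ` {t (Suc n)..<b (Suc n)}" using that by simp
      then have "e v \<in> f ` {p (Suc n)..<q (Suc n)}" using cover[of "Suc n"] sub by blast
      then show ?thesis by (rule confine)
    qed
    show "u n \<le> t (Suc n)" using * tb by blast
    \<comment> \<open>The right endpoint is excluded from the covered piece, so its bound is
      obtained as a limit.\<close>
    show "b (Suc n) \<le> b' n"
      by (rule dense_le_bounded[OF tb[of "Suc n"]]) (use * in auto)
  qed
  have "t n \<le> t (Suc n)" "b (Suc n) \<le> b n" for n
    using tu[of n] b[of n] nested[of n] by linarith+
  then have "incseq t" "decseq b" by (blast intro: incseq_SucI decseq_SucI)+
  have t_le_b: "t m \<le> b n" for m n
    using \<open>incseq t\<close> \<open>decseq b\<close> tb[of "max m n"]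
    by (smt (verit) incseq_def decseq_def max.cobounded1 max.cobounded2)
  define z where "z = (SUP n. t n)"
  have "bdd_above (range t)" using t_le_b[of _ 0] by (auto intro!: bdd_aboveI)
  then have "t n \<le> z" for n unfolding z_def by (intro cSUP_upper) auto
  then have t_less: "t n < z" for n using tu[of n] nested(1)[of n] by (meson less_le_trans)
  have "z \<le> b n" for n unfolding z_def using t_le_b by (intro cSUP_least) auto
  then have less_b: "z < b n" for n using b[of n] nested(2)[of n] by (meson le_less_trans order_trans)
  \<comment> \<open>\<open>y\<close> lies to the left of every discarded part, so
    \<open>{y..<q n}\<close> contains the one covering \<open>{t n..<b n}\<close>.\<close>
  have trace: "e v \<in> f ` {y..<q n}" if "t n \<le> v" "v \<le> z" for v n
  proof -
    have "e v \<in> f ` {q (Suc n)..<q n}" using cover[of n] that less_b[of n] by auto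
    then show ?thesis using y_le[of "Suc n"] by auto
  qed
  have "f y = e z"
  proof (rule ccontr)
    assume "f y \<noteq> e z"
    moreover have "f y \<in> topspace X" "e z \<in> topspace X"
      using continuous_map_image_subset_topspace[OF continuous_f]
        continuous_map_image_subset_topspace[OF continuous_e] by auto
    ultimately obtain U where U: "openin X U" "f y \<in> U" "e z \<notin> U"
      using t1 unfolding t1_space_def by metis
    obtain \<epsilon> where "\<epsilon> > 0" "f ` {y..<y+\<epsilon>} \<subseteq> U" using f_contD[OF U(1,2)] .
    then obtain n where "f ` {y..<q n} \<subseteq> U" using near by (meson image_mono order_trans)
    then show False using trace[of n z] t_less[of n] U(3) by auto
  qed
  \<comment> \<open>A neighbourhood of \<open>e z\<close> can exclude all points of the copy coming
    from the left of \<open>z\<close>, in particular every \<open>e (t n)\<close>.\<close>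
  obtain U where U: "openin X U" "\<And>v. e v \<in> U \<longleftrightarrow> v \<in> {z..<z+1}"
    using embedding_e[of z "z+1"] by blast
  have "f y \<in> U" using U(2)[of z] \<open>f y = e z\<close> by simp
  then obtain \<epsilon> where "\<epsilon> > 0" "f ` {y..<y+\<epsilon>} \<subseteq> U" using f_contD[OF U(1)] by blast
  then obtain n where "f ` {y..<q n} \<subseteq> U" using near by (meson image_mono order_trans)
  then have "e (t n) \<in> U" using trace[of n "t n"] t_less[of n] by auto
  then show False using U(2)[of "t n"] t_less[of n] by simp
qed

section \<open>Maps injective on an interval\<close>

lemma not_inj_on_interval:
  assumes "p < q"
  shows "\<not> inj_on f {p..<q}"
proof
  assume inj: "inj_on f {p..<q}"
  have "f ` {p..<q} \<noteq> {}" using assms by simp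
  then obtain s where s: "e s \<in> f ` {p..<q}"
    using dense[OF openin_image[of p q]] by blast
  obtain d where d: "d > 0" "e ` {s..<s+d} \<subseteq> f ` {p..<q}" using e_contD[OF openin_image s] .
  define g where "g v = the_inv_into {p..<q} f (e v)" for v
  have g: "p \<le> g v" "g v < q" "f (g v) = e v" if "s \<le> v" "v < s+d" for v
  proof -
    have "e v \<in> f ` {p..<q}" using that d by auto
    then show "p \<le> g v" "g v < q" "f (g v) = e v"
      using the_inv_into_into[OF inj, of "e v" "{p..<q}"] f_the_inv_into_f[OF inj]
      by (auto simp: g_def)
  qed
  have g_eq: "g v = w" if "f w = e v" "p \<le> w" "w < q" for v w
    using the_inv_into_f_f[OF inj, of w] that by (simp add: g_def)
  \<comment> \<open>Openness of \<open>f\<close> makes \<open>g\<close> continuous between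
    Sorgenfrey lines; as basic neighbourhoods of \<open>g r\<close> extend only to the right,
    \<open>g r\<close> is a minimum on some right neighbourhood of \<open>r\<close>.\<close>
  have g_right: "\<exists>\<delta>>0. \<forall>v. r \<le> v \<and> v < r+\<delta> \<longrightarrow> g r \<le> g v \<and> g v < g r + \<epsilon>"
    if "s \<le> r" "r < s+d" "\<epsilon> > 0" for r \<epsilon>
  proof -
    have "e r \<in> f ` {g r..<min q (g r + \<epsilon>)}" using g[OF that(1,2)] that(3)
      by (metis atLeastLessThan_iff image_eqI less_add_same_cancel1 min_less_iff_conj order_refl)
    then obtain \<delta> where \<delta>: "\<delta> > 0" "e ` {r..<r+\<delta>} \<subseteq> f ` {g r..<min q (g r + \<epsilon>)}"
      using e_contD[OF openin_image] by blast
    have "g r \<le> g v \<and> g v < g r + \<epsilon>" if v: "r \<le> v" "v < r+\<delta>" for v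
    proof -
      have "e v \<in> f ` {g r..<min q (g r + \<epsilon>)}" using \<delta>(2) v by auto
      then obtain w where "f w = e v" "g r \<le> w" "w < q" "w < g r + \<epsilon>" by auto
      then show ?thesis using g_eq[of w v] g(1)[OF \<open>s \<le> r\<close> \<open>r < s+d\<close>] by auto
    qed
    then show ?thesis using \<delta>(1) by blast
  qed
  \<comment> \<open>\<open>E n\<close> collects the points where this minimality holds on a right
    neighbourhood of uniform length.\<close>
  define E where "E n = {r. s < r \<and> r < s+d \<and> (\<forall>v. r \<le> v \<and> v < r + inverse (Suc n) \<longrightarrow> g r \<le> g v)}"
    for n :: nat
  have "{s<..<s+d} \<subseteq> (\<Union>n. E n)"
  proof
    fix r assume r: "r \<in> {s<..<s+d}"
    then obtain \<delta> where \<delta>: "\<delta> > 0" "\<forall>v. r \<le> v \<and> v < r+\<delta> \<longrightarrow> g r \<le> g v"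
      using g_right[of r 1] by auto
    obtain n where "inverse (Suc n) < \<delta>" using reals_Archimedean[OF \<delta>(1)] by auto
    then have "r \<in> E n" using r \<delta>(2) by (auto simp: E_def)
    then show "r \<in> (\<Union>n. E n)" by blast
  qed
  then obtain n a b where ab: "s < a" "a < b" "b < s+d" "{a<..<b} \<subseteq> closure (E n)"
    using countable_cover_dense_in_interval[of s "s+d"] d(1) by (metis less_add_same_cancel1)
  \<comment> \<open>With this length bound, each \<open>r\<close> in \<open>E n\<close> between
    \<open>a\<close> and \<open>c\<close> satisfies g r \<le> g w for all \<open>w\<close> in
    \<open>{r..<c}\<close>.\<close>
  define c where "c = min b (a + inverse (Suc n))"
  have c: "a < c" "c \<le> b" "c \<le> a + inverse (Suc n)" using ab by (auto simp: c_def)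
  \<comment> \<open>Local minimality at \<open>v\<close> gives g v \<le> g r for a nearby
    \<open>r\<close> in the dense set \<open>E n\<close>, and then g r \<le> g w; injectivity of
    \<open>e\<close> makes the inequality strict.\<close>
  have mono: "g v < g w" if "a < v" "v < w" "w < c" for v w
  proof -
    have "s \<le> v" "v < s+d" using that ab c by linarith+
    then obtain \<delta> where \<delta>: "\<delta> > 0" "\<forall>r. v \<le> r \<and> r < v+\<delta> \<longrightarrow> g v \<le> g r"
      using g_right[of v 1] by (meson zero_less_one)
    define w' where "w' = min w (v+\<delta>)"
    have "{v<..<w'} \<noteq> {}" using that \<delta> by (simp add: w'_def)
    moreover have "{v<..<w'} \<subseteq> closure (E n)"
      using ab(4) that c by (force simp: w'_def)
    ultimately have "{v<..<w'} \<inter> E n \<noteq> {}"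
      using open_Int_closure_eq_empty[of "{v<..<w'}" "E n"]
      by (metis inf.absorb_iff1 open_greaterThanLessThan)
    then obtain r where r: "v < r" "r < w'" "r \<in> E n" by auto
    have "g v \<le> g r" using \<delta>(2) r by (auto simp: w'_def)
    also have "g r \<le> g w" using r that c by (auto simp: E_def w'_def)
    finally have "g v \<le> g w" .
    moreover have "g v \<noteq> g w"
      using g(3)[of v] g(3)[of w] that ab c injD[OF inj_e, of v w] by force
    ultimately show ?thesis by simp
  qed
  \<comment> \<open>Both endpoints lie strictly between \<open>a\<close> and \<open>c\<close>, so
    \<open>mono\<close> applies to them too.\<close>
  define a' b' where "a' = (2*a + c)/3" and "b' = (a + 2*c)/3"
  have a'b': "a < a'" "a' < b'" "b' < c" using c(1) by (auto simp: a'_def b'_def)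
  have sub: "s \<le> v" "v < s+d" if "a' \<le> v" "v \<le> b'" for v using that a'b' ab c by auto
  obtain U where U: "openin X U" "\<And>v. e v \<in> U \<longleftrightarrow> v \<in> {a'..<b'}"
    using embedding_e[of a' b'] by blast
  have "e a' \<in> U \<inter> f ` {g a'..<g b'}"
    using U(2)[of a'] g(3)[OF sub, of a'] a'b' mono[of a' b'] by (auto intro: image_eqI[of _ _ "g a'"])
  then obtain x where x: "x \<in> U \<inter> f ` {g a'..<g b'} - range e"
    using codense[of "U \<inter> f ` {g a'..<g b'}"] U(1) openin_image by blast
  then obtain y where y: "g a' \<le> y" "y < g b'" "f y = x" "x \<in> U" "x \<notin> range e" by auto
  have y_range: "p \<le> y" "y < q"
    using y(1,2) g(1)[OF sub, of a'] g(2)[OF sub, of b'] a'b' by auto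
  have g_neq: "g v \<noteq> y" if "a' \<le> v" "v \<le> b'" for v
    using g(3)[OF sub[OF that]] y by force
  \<comment> \<open>\<open>t\<close> is where the increasing \<open>g\<close> jumps over the omitted
    value \<open>y\<close>; right continuity excludes \<open>g t < y\<close>, so
    \<open>{y..<g t}\<close> is a gap in the values of \<open>g\<close> on
    \<open>{a'..b'}\<close>.\<close>
  define T where "T = {v. a' \<le> v \<and> v \<le> b' \<and> y < g v}"
  define t where "t = Inf T"
  have T: "b' \<in> T" "bdd_below T" using a'b' y by (auto simp: T_def intro: bdd_belowI)
  have t: "a' \<le> t" "t \<le> b'"
    unfolding t_def using T by (auto intro!: cInf_greatest cInf_lower simp: T_def)
  have below: "g v < y" if "a' \<le> v" "v < t" for v
  proof -
    have "v \<notin> T" using cInf_lower[OF _ T(2), of v] that by (auto simp: t_def)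
    then show ?thesis using that t g_neq[of v] by (auto simp: T_def)
  qed
  have above: "y < g t"
  proof (rule ccontr)
    assume "\<not> y < g t"
    then have "g t < y" using g_neq[OF t] by simp
    then obtain \<delta> where \<delta>: "\<delta> > 0" "\<forall>v. t \<le> v \<and> v < t+\<delta> \<longrightarrow> g v < g t + (y - g t)"
      using g_right[OF sub[OF t], of "y - g t"] by auto
    obtain v where "v \<in> T" "v < t + \<delta>"
      using cInf_lessD[of T "t+\<delta>"] T \<delta>(1) by (auto simp: t_def)
    moreover have "t \<le> v" unfolding t_def using calculation(1) T(2) by (rule cInf_lower)
    ultimately show False using \<delta>(2) by (auto simp: T_def)
  qed
  \<comment> \<open>The image of the gap, cut down by \<open>U\<close>, is a nonempty open set.
    Density puts some \<open>e v\<close> in it; \<open>U\<close> forces \<open>v\<close> into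
    \<open>{a'..<b'}\<close>, so \<open>g v\<close> falls in the gap.\<close>
  have "x \<in> U \<inter> f ` {y..<g t}" using y above by auto
  then obtain v where v: "e v \<in> U" "e v \<in> f ` {y..<g t}"
    using dense[of "U \<inter> f ` {y..<g t}"] U(1) openin_image by blast
  then have "a' \<le> v" "v < b'" using U(2)[of v] by auto
  obtain w where w: "f w = e v" "y \<le> w" "w < g t" using v(2) by auto
  then have "g v = w" using g_eq[of w v] y_range g(2)[OF sub[OF t]] by auto
  show False
  proof (cases "v < t")
    case True
    then show ?thesis using below[of v] \<open>a' \<le> v\<close> \<open>g v = w\<close> w by auto
  next
    case False
    then have "g t \<le> g v"
      using mono[of t v] \<open>v < b'\<close> t a'b' by (cases "t = v") auto
    then show ?thesis using \<open>g v = w\<close> w by auto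
  qed
qed

end

section \<open>Transfer to a dense, codense subspace\<close>

theorem mainTheorem12:
  fixes X :: "'a topology" and S :: "'a set"
  assumes "Hausdorff_space X"
    and "S \<subseteq> topspace X"
    and "X closure_of S = topspace X"
    and "X closure_of (topspace X - S) = topspace X"
    and "subtopology X S homeomorphic_space sorgenfrey_line"
  shows "\<not> (\<exists>f. continuous_map sorgenfrey_line X f \<and> open_map sorgenfrey_line X f
              \<and> f ` topspace sorgenfrey_line = topspace X)"
proof
  assume "\<exists>f. continuous_map sorgenfrey_line X f \<and> open_map sorgenfrey_line X f
              \<and> f ` topspace sorgenfrey_line = topspace X"
  then obtain f where f: "continuous_map sorgenfrey_line X f" "open_map sorgenfrey_line X f"
    by blast
  obtain e where e: "homeomorphic_map sorgenfrey_line (subtopology X S) e"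
    using assms(5) homeomorphic_space homeomorphic_space_sym by blast
  have range_e: "range e = S"
    using homeomorphic_imp_surjective_map[OF e] assms(2) by (simp add: inf_absorb2)
  have inj_e: "inj e" using homeomorphic_imp_injective_map[OF e] by simp
  interpret dense_codense_sorgenfrey_copy X f e
  proof
    show "t1_space X" using assms(1) by (rule Hausdorff_imp_t1_space)
    show "continuous_map sorgenfrey_line X e"
      using homeomorphic_imp_continuous_map[OF e] continuous_map_in_subtopology by blast
    show "\<exists>U. openin X U \<and> (\<forall>v. e v \<in> U \<longleftrightarrow> v \<in> {s..<s'})" for s s'
    proof -
      have "openin (subtopology X S) (e ` {s..<s'})"
        using homeomorphic_imp_open_map[OF e] openin_sorgenfrey_line_atLeastLessThan
        by (simp add: open_map_def)
      then obtain U where U: "openin X U" "e ` {s..<s'} = U \<inter> S"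
        by (auto simp: openin_subtopology)
      \<comment> \<open>Injectivity of \<open>e\<close> turns the image identity for the trace on
        \<open>S\<close> into a condition on parameters.\<close>
      have "e v \<in> U \<longleftrightarrow> v \<in> {s..<s'}" for v
        using U(2) range_e inj_image_mem_iff[OF inj_e, of v "{s..<s'}"] by auto
      then show ?thesis using U(1) by blast
    qed
    show "\<exists>s. e s \<in> U" if "openin X U" "U \<noteq> {}" for U
      using dense_intersects_open[of X S] that assms(3) range_e by auto
    show "U - range e \<noteq> {}" if "openin X U" "U \<noteq> {}" for U
      using dense_intersects_open[of X "topspace X - S"] that assms(4) range_e by auto
  qed (fact f)+
  show False using inj_on_some_interval not_inj_on_interval by blast
qed

end
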